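(* Let $X$ be a subshift generated by a proper, unimodular and primitive directive sequence $\boldsymbol\tau = (\tau_n \colon \mathcal A_{n+1}^* \to \mathcal A_n^* : n \geq 0)$. Then, for any $n\geq 0$ and any non-empty word $u\in\mathcal L(X_{\boldsymbol\tau}^{(n)})$, the set of integer linear combinations of the abelianizations of the return words to $u$ in $X_{\boldsymbol\tau}^{(n)}$ equals $\mathbb Z^{\mathcal A_n}$. In particular, each $X_{\boldsymbol\tau}^{(n)}$ admits no nontrivial letter-coboundary.
   Context: Alphabets are finite sets with at least two elements; $\mathcal A^*$ is the free monoid over $\mathcal A$. $\mathcal L(X)$ is the set of finite words occurring in points of a subshift $X$. A substitution $\tau:\mathcal A^*\to\mathcal B^*$ is a monoid morphism such that $\tau(a)$ is non-empty for every $a\in\mathcal A$ and every $b\in\mathcal B$ occurs in some $\tau(a)$. It is proper if there are letters $b,b'\in\mathcal B$ such that every $\tau(a)$ starts with $b$ and ends with $b'$. Its incidence matrix is the $\mathcal B\times\mathcal A$ matrix whose $(b,a)$ entry is the number of occurrences of $b$ in $\tau(a)$. A directive sequence $\boldsymbol\tau=(\tau_n)_{n\ge0}$ consists of substitutions $\tau_n:\mathcal A_{n+1}^*\to\mathcal A_n^*$; it is proper if every $\tau_n$ is proper, and unimodular if each incidence matrix is square with determinant $\pm1$. With $\tau_{n,m}=\tau_n\circ\cdots\circ\tau_{m-1}$ for $m>n$, it is primitive if for every $n$ there is $m>n$ such that every letter of $\mathcal A_n$ occurs in $\tau_{n,m}(a)$ for every $a\in\mathcal A_m$. $X^{(n)}_{\boldsymbol\tau}$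 is the set of $x\in\mathcal A_n^{\mathbb Z}$ such that every finite factor of $x$ occurs in $\tau_{n,m}(a)$ for some $m>n$, $a\in\mathcal A_m$; $\boldsymbol\tau$ generates $X$ if $X=X^{(0)}_{\boldsymbol\tau}$. A return word to a non-empty word $u\in\mathcal L(Y)$ in a subshift $Y\subseteq\mathcal A^{\mathbb Z}$ is a word $w\in\mathcal A^*$ such that $wu\in\mathcal L(Y)$ and $wu$ contains exactly two occurrences of $u$, one as a prefix and one as a suffix. The abelianization (Parikh vector) of $w$ is the vector in $\mathbb Z^{\mathcal A}$ whose $a$-th coordinate is the number of occurrences of $a$ in $w$. A letter-coboundary in $Y$ is a monoid morphism $c:\mathcal A^*\to(\mathbb R,+)$ such that $c(w)=0$ for every letter $a$ and every return word $w$ to $a$ in $Y$; it is trivial if $c(a)=0$ for all $a\in\mathcal A$. *)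

theory Defs
  imports
    "HOL-Analysis.Function_Topology"
    "HOL-Library.Sublist"
    "Jordan_Normal_Form.Determinant"
begin

(* Words over an alphabet A are the elements of lists A. All alphabets are finite subsets of
   type variables; in a directive sequence the alphabets A 0, A 1, ... may be arbitrary
   different subsets of one type (any sequence of finite sets embeds into, say, nat). Maps
   defined on words are total HOL functions, constrained only on lists A. *)

definition alphabet :: "'a set \<Rightarrow> bool" where
  "alphabet A \<longleftrightarrow> finite A \<and> card A \<ge> 2"

definition substitution :: "'a set \<Rightarrow> 'b set \<Rightarrow> ('a list \<Rightarrow> 'b list) \<Rightarrow> bool" where
  "substitution A B \<tau> \<longleftrightarrow>
     \<tau> ` lists A \<subseteq> lists B \<and>
     \<tau> [] = [] \<and>
     (\<forall>v\<in>lists A. \<forall>w\<in>lists A. \<tau> (v @ w) = \<tau> v @ \<tau> w) \<and>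
     (\<forall>a\<in>A. \<tau> [a] \<noteq> []) \<and>
     (\<forall>b\<in>B. \<exists>a\<in>A. b \<in> set (\<tau> [a]))"

definition proper_subst :: "'a set \<Rightarrow> 'b set \<Rightarrow> ('a list \<Rightarrow> 'b list) \<Rightarrow> bool" where
  "proper_subst A B \<tau> \<longleftrightarrow>
     (\<exists>b\<in>B. \<exists>b'\<in>B. \<forall>a\<in>A. prefix [b] (\<tau> [a]) \<and> suffix [b'] (\<tau> [a]))"

(* The incidence matrix with columns indexed by the list as and rows by the list bs. *)
definition incidence_mat :: "'a list \<Rightarrow> 'b list \<Rightarrow> ('a list \<Rightarrow> 'b list) \<Rightarrow> int mat" where
  "incidence_mat as bs \<tau> =
     mat (length bs) (length as) (\<lambda>(i, j). int (count_list (\<tau> [as ! j]) (bs ! i)))"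

(* Rows and columns are indexed by two different alphabets, so the determinant is defined
   only after enumerating both. Another choice of enumerations permutes rows and columns and
   changes the determinant at most by a sign, so some enumerations give 1 or -1 iff all do. *)
definition unimodular_subst :: "'a set \<Rightarrow> 'b set \<Rightarrow> ('a list \<Rightarrow> 'b list) \<Rightarrow> bool" where
  "unimodular_subst A B \<tau> \<longleftrightarrow>
     (\<exists>as bs. distinct as \<and> set as = A \<and> distinct bs \<and> set bs = B \<and>
        square_mat (incidence_mat as bs \<tau>) \<and>
        det (incidence_mat as bs \<tau>) \<in> {1, -1})"

definition directive_sequence :: "(nat \<Rightarrow> 'a set) \<Rightarrow> (nat \<Rightarrow> 'a list \<Rightarrow> 'a list) \<Rightarrow> bool" where
  "directive_sequence A \<tau> \<longleftrightarrow>
     (\<forall>n. alphabet (A n)) \<and> (\<forall>n. substitution (A (Suc n)) (A n) (\<tau> n))"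

definition proper_seq :: "(nat \<Rightarrow> 'a set) \<Rightarrow> (nat \<Rightarrow> 'a list \<Rightarrow> 'a list) \<Rightarrow> bool" where
  "proper_seq A \<tau> \<longleftrightarrow> (\<forall>n. proper_subst (A (Suc n)) (A n) (\<tau> n))"

definition unimodular_seq :: "(nat \<Rightarrow> 'a set) \<Rightarrow> (nat \<Rightarrow> 'a list \<Rightarrow> 'a list) \<Rightarrow> bool" where
  "unimodular_seq A \<tau> \<longleftrightarrow> (\<forall>n. unimodular_subst (A (Suc n)) (A n) (\<tau> n))"

(* subst_comp t n m = t n o t (n+1) o ... o t (m-1), for n < m *)
definition subst_comp ::
  "(nat \<Rightarrow> 'a list \<Rightarrow> 'a list) \<Rightarrow> nat \<Rightarrow> nat \<Rightarrow> 'a list \<Rightarrow> 'a list" where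
  "subst_comp \<tau> n m = foldr (\<circ>) (map \<tau> [n..<m]) id"

definition primitive_seq :: "(nat \<Rightarrow> 'a set) \<Rightarrow> (nat \<Rightarrow> 'a list \<Rightarrow> 'a list) \<Rightarrow> bool" where
  "primitive_seq A \<tau> \<longleftrightarrow>
     (\<forall>n. \<exists>m>n. \<forall>b\<in>A n. \<forall>a\<in>A m. b \<in> set (subst_comp \<tau> n m [a]))"

definition subshift :: "'a set \<Rightarrow> (int \<Rightarrow> 'a) set \<Rightarrow> bool" where
  "subshift A X \<longleftrightarrow>
     closedin (product_topology (\<lambda>_. discrete_topology A) UNIV) X \<and>
     (\<lambda>x i. x (i + 1)) ` X = X"

definition factor :: "(int \<Rightarrow> 'a) \<Rightarrow> int \<Rightarrow> nat \<Rightarrow> 'a list" where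
  "factor x i l = map (\<lambda>k. x (i + int k)) [0..<l]"

definition language :: "(int \<Rightarrow> 'a) set \<Rightarrow> 'a list set" where
  "language X = {factor x i l | x i l. x \<in> X}"

definition level_subshift ::
  "(nat \<Rightarrow> 'a set) \<Rightarrow> (nat \<Rightarrow> 'a list \<Rightarrow> 'a list) \<Rightarrow> nat \<Rightarrow> (int \<Rightarrow> 'a) set" where
  "level_subshift A \<tau> n =
     {x. range x \<subseteq> A n \<and>
         (\<forall>i l. \<exists>m>n. \<exists>a\<in>A m. sublist (factor x i l) (subst_comp \<tau> n m [a]))}"

definition generates ::
  "(nat \<Rightarrow> 'a set) \<Rightarrow> (nat \<Rightarrow> 'a list \<Rightarrow> 'a list) \<Rightarrow> (int \<Rightarrow> 'a) set \<Rightarrow> bool" where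
  "generates A \<tau> X \<longleftrightarrow> X = level_subshift A \<tau> 0"

definition occurrences :: "'a list \<Rightarrow> 'a list \<Rightarrow> nat set" where
  "occurrences u v = {i. i + length u \<le> length v \<and> take (length u) (drop i v) = u}"

definition return_words :: "'a set \<Rightarrow> (int \<Rightarrow> 'a) set \<Rightarrow> 'a list \<Rightarrow> 'a list set" where
  "return_words A Y u =
     {w \<in> lists A. w @ u \<in> language Y \<and> card (occurrences u (w @ u)) = 2 \<and>
        prefix u (w @ u) \<and> suffix u (w @ u)}"

(* Z^A, with integer vectors extended by 0 outside A. *)
definition int_vectors :: "'a set \<Rightarrow> ('a \<Rightarrow> int) set" where
  "int_vectors A = {v. \<forall>a. a \<notin> A \<longrightarrow> v a = 0}"

definition abelianization :: "'a list \<Rightarrow> 'a \<Rightarrow> int" where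
  "abelianization w = (\<lambda>a. int (count_list w a))"

definition int_combinations :: "('a \<Rightarrow> int) set \<Rightarrow> ('a \<Rightarrow> int) set" where
  "int_combinations V =
     {\<lambda>a. \<Sum>v\<in>F. k v * v a | F (k :: ('a \<Rightarrow> int) \<Rightarrow> int). finite F \<and> F \<subseteq> V}"

definition letter_coboundary ::
  "'a set \<Rightarrow> (int \<Rightarrow> 'a) set \<Rightarrow> ('a list \<Rightarrow> real) \<Rightarrow> bool" where
  "letter_coboundary A Y c \<longleftrightarrow>
     c [] = 0 \<and>
     (\<forall>v\<in>lists A. \<forall>w\<in>lists A. c (v @ w) = c v + c w) \<and>
     (\<forall>a\<in>A. \<forall>w\<in>return_words A Y [a]. c w = 0)"

definition trivial_coboundary :: "'a set \<Rightarrow> ('a list \<Rightarrow> real) \<Rightarrow> bool" where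
  "trivial_coboundary A c \<longleftrightarrow> (\<forall>a\<in>A. c [a] = 0)"

end

theory Submission
  imports Defs "HOL-Library.Function_Algebras"
begin

text \<open>
  The proof combines a recurrence argument with an invertibility argument.

  Let $u$ be a word of the language of level $n$. By primitivity there is a level $m$ such that $u$
  occurs in $\tau_{n,m}(b)$ for every letter $b$ of level $m$. Since $\tau_m$ is proper, all words
  $\tau_m(a)$ start with one letter $b$; hence all words $\tau_{n,m+1}(a)$ start with
  $\tau_{n,m}(b)$ and have the form $p u r_a$ with the same prefix $p$. If $ab$ is a two-letter
  word of level $m+1$, then $\tau_{n,m+1}(ab) = p u r_a p u r_b$ contains $(u r_a p) u$, which
  starts and ends with $u$ and can therefore be cut at the occurrences of $u$ into return words.
  As $u r_a p$ is a rearrangement of $\tau_{n,m+1}(a)$, the abelianization of $\tau_{n,m+1}(a)$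
  is a sum of abelianizations of return words (lemma \<open>generator_image_in_span\<close>).

  The abelianizations of the words $\tau_{n,m+1}(a)$ are the columns of a product of
  integer matrices of determinant $\pm 1$, so they generate the whole integer lattice
  (lemmas \<open>unimodular_columns\<close> and \<open>unimodular_descent\<close>).

  The argument needs to know which words belong to the language of level $n$. By definition these
  are the words occurring in bi-infinite points, but the argument produces words occurring in some
  $\tau_{n,m}(a)$. The two classes agree (lemma \<open>language_level_subshift\<close>), because a word of the
  second kind can be extended on both sides to another one, and iterating this builds a point.
\<close>

section \<open>Integer spans of abelianizations\<close>

interpretation int_fun: Modules.module "\<lambda>(k::int) (v :: 'a \<Rightarrow> int). (\<lambda>a. k * v a)"
  by unfold_locales (auto simp: fun_eq_iff algebra_simps)

lemma sum_fun_apply: "(\<Sum>i\<in>I. f i) x = (\<Sum>i\<in>I. f i x)" for f :: "'i \<Rightarrow> 'a \<Rightarrow> int"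
  by (induction I rule: infinite_finite_induct) auto

lemma int_combinations_eq_span: "int_combinations V = int_fun.span V"
proof -
  have "(\<Sum>v\<in>F. (\<lambda>a. k v * v a)) = (\<lambda>a. \<Sum>v\<in>F. k v * v a)"
    for F and k :: "('a \<Rightarrow> int) \<Rightarrow> int"
    by (rule ext) (simp add: sum_fun_apply)
  then show ?thesis
    unfolding int_combinations_def int_fun.span_explicit by simp
qed

lemma abelianization_append: "abelianization (v @ w) = abelianization v + abelianization w"
  by (auto simp: abelianization_def fun_eq_iff)

lemma abelianization_Nil: "abelianization [] = 0"
  by (auto simp: abelianization_def fun_eq_iff)

lemma abelianization_in_int_vectors: "w \<in> lists A \<Longrightarrow> abelianization w \<in> int_vectors A"
  by (auto simp: abelianization_def int_vectors_def count_list_0_iff)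

lemma int_vectors_subset_span:
  assumes "finite A" and "\<And>a. a \<in> A \<Longrightarrow> abelianization [a] \<in> int_fun.span S"
  shows "int_vectors A \<subseteq> int_fun.span S"
proof
  fix v assume v: "v \<in> int_vectors A"
  have "v = (\<Sum>a\<in>A. (\<lambda>x. v a * abelianization [a] x))"
  proof
    fix x
    have "(\<Sum>a\<in>A. v a * abelianization [a] x) = (\<Sum>a\<in>A. if a = x then v a else 0)"
      by (intro sum.cong) (auto simp: abelianization_def)
    also have "\<dots> = v x"
      using assms(1) v by (auto simp: int_vectors_def)
    finally show "v x = (\<Sum>a\<in>A. (\<lambda>x. v a * abelianization [a] x)) x"
      by (simp add: sum_fun_apply)
  qed
  also have "\<dots> \<in> int_fun.span S"
    by (intro int_fun.span_sum int_fun.span_scale assms(2))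
  finally show "v \<in> int_fun.span S" .
qed

lemma span_subset_int_vectors:
  assumes "W \<subseteq> lists A"
  shows "int_fun.span (abelianization ` W) \<subseteq> int_vectors A"
proof (rule int_fun.span_minimal)
  show "abelianization ` W \<subseteq> int_vectors A"
    by (intro image_subsetI abelianization_in_int_vectors subsetD[OF assms])
  show "int_fun.subspace (int_vectors A)"
    by (rule int_fun.subspaceI) (simp_all add: int_vectors_def)
qed

section \<open>Substitutions\<close>

lemma substitutionD:
  assumes "substitution A B \<tau>"
  shows "w \<in> lists A \<Longrightarrow> \<tau> w \<in> lists B"
    and "\<tau> [] = []"
    and "v \<in> lists A \<Longrightarrow> w \<in> lists A \<Longrightarrow> \<tau> (v @ w) = \<tau> v @ \<tau> w"
    and "a \<in> A \<Longrightarrow> \<tau> [a] \<noteq> []"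
    and "b \<in> B \<Longrightarrow> \<exists>a\<in>A. b \<in> set (\<tau> [a])"
  using assms unfolding substitution_def by blast+

lemma substitution_id: "substitution A A id"
  by (auto simp: substitution_def)

lemma substitution_sublist:
  assumes "substitution A B \<tau>" "w \<in> lists A" "sublist v w"
  shows "sublist (\<tau> v) (\<tau> w)"
proof -
  obtain p s where w: "w = p @ v @ s" using assms(3) unfolding sublist_def by blast
  with assms(2) have "p \<in> lists A" "v \<in> lists A" "s \<in> lists A" by auto
  then have "\<tau> w = \<tau> p @ \<tau> v @ \<tau> s"
    by (simp add: w substitutionD(3)[OF assms(1)])
  then show ?thesis unfolding sublist_def by blast
qed

lemma sublist_singleton_iff: "sublist [a] w \<longleftrightarrow> a \<in> set w"
proof
  assume "a \<in> set w"
  then obtain p s where "w = p @ [a] @ s" by (metis append_Cons append_Nil split_list)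
  then show "sublist [a] w" unfolding sublist_def by blast
qed (auto dest: set_mono_sublist)

lemma substitution_comp:
  assumes "substitution A B \<sigma>" "substitution B C \<rho>"
  shows "substitution A C (\<rho> \<circ> \<sigma>)"
proof -
  note s = substitutionD[OF assms(1)] and r = substitutionD[OF assms(2)]
  have "\<rho> (\<sigma> [a]) \<noteq> []" if a: "a \<in> A" for a
  proof -
    obtain b w where bw: "\<sigma> [a] = [b] @ w" using s(4)[OF a] by (cases "\<sigma> [a]") auto
    have "[a] \<in> lists A" using a by auto
    then have "[b] \<in> lists B" "w \<in> lists B" using s(1)[of "[a]"] bw by auto
    then have "\<rho> (\<sigma> [a]) = \<rho> [b] @ \<rho> w" and "b \<in> B"
      unfolding bw using r(3)[of "[b]" w] by simp_all
    then show ?thesis using r(4)[of b] by auto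
  qed
  moreover have "\<exists>a\<in>A. c \<in> set (\<rho> (\<sigma> [a]))" if c: "c \<in> C" for c
  proof -
    obtain b where b: "b \<in> B" "c \<in> set (\<rho> [b])" using r(5)[OF c] by blast
    obtain a where a: "a \<in> A" "b \<in> set (\<sigma> [a])" using s(5)[OF b(1)] by blast
    have "\<sigma> [a] \<in> lists B" using a(1) by (intro s(1)) auto
    then have "sublist (\<rho> [b]) (\<rho> (\<sigma> [a]))"
      using a(2) by (intro substitution_sublist[OF assms(2)]) (auto simp: sublist_singleton_iff)
    then show ?thesis using a(1) b(2) by (blast dest: set_mono_sublist)
  qed
  ultimately show ?thesis
    unfolding substitution_def using s(1,2,3) r(1,2,3) by (auto simp: image_subset_iff)
qed

text \<open>The action of a substitution on abelianizations is linear: it is multiplication by the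
  incidence matrix.\<close>

lemma abelianization_substitution:
  assumes "substitution A B \<sigma>" "finite A" "w \<in> lists A"
  shows "abelianization (\<sigma> w) x = (\<Sum>a\<in>A. abelianization w a * abelianization (\<sigma> [a]) x)"
  using assms(3)
proof (induction w)
  case Nil
  then show ?case by (simp add: substitutionD(2)[OF assms(1)] abelianization_Nil)
next
  case (Cons c w)
  have "\<sigma> (c # w) = \<sigma> [c] @ \<sigma> w"
    using substitutionD(3)[OF assms(1), of "[c]" w] Cons by simp
  moreover have "(\<Sum>a\<in>A. abelianization (c # w) a * abelianization (\<sigma> [a]) x) =
      (\<Sum>a\<in>A. (if a = c then abelianization (\<sigma> [a]) x else 0) +
        abelianization w a * abelianization (\<sigma> [a]) x)"
    by (intro sum.cong) (auto simp: abelianization_def algebra_simps)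
  ultimately show ?case
    using Cons assms(2) by (simp add: abelianization_append sum.distrib)
qed

text \<open>The coefficients are a column of the adjugate matrix, up to the sign of the determinant:
  for an integer matrix of determinant $\pm 1$ this is the inverse.\<close>

lemma unimodular_columns:
  assumes sub: "substitution A B \<sigma>" and uni: "unimodular_subst A B \<sigma>" and b: "b \<in> B"
  shows "\<exists>k. \<forall>c. abelianization [b] c = (\<Sum>a\<in>A. k a * abelianization (\<sigma> [a]) c)"
proof -
  obtain as bs where as: "distinct as" "set as = A" and bs: "distinct bs" "set bs = B"
    and sq: "square_mat (incidence_mat as bs \<sigma>)"
    and det: "det (incidence_mat as bs \<sigma>) \<in> {1, -1}"
    using uni unfolding unimodular_subst_def by blast
  define M where "M = incidence_mat as bs \<sigma>"
  define N where "N = length as"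
  define K where "K = adj_mat M"
  have len: "length bs = N" using sq by (simp add: incidence_mat_def N_def)
  have M: "M \<in> carrier_mat N N" by (simp add: M_def incidence_mat_def N_def len[unfolded N_def])
  have K: "K \<in> carrier_mat N N" and MK: "M * K = det M \<cdot>\<^sub>m 1\<^sub>m N"
    using adj_mat[OF M] by (simp_all add: K_def)
  obtain j where j: "j < N" "bs ! j = b" using b bs len by (metis in_set_conv_nth)
  have bij: "bij_betw (\<lambda>l. as ! l) {..<N} A"
    using as by (auto simp: N_def intro: bij_betw_nth)
  define k where "k = (\<lambda>a. det M * K $$ (the_inv_into {..<N} (\<lambda>l. as ! l) a, j))"
  have k: "k (as ! l) = det M * K $$ (l, j)" if "l < N" for l
    using that bij by (simp add: k_def bij_betw_def the_inv_into_f_f)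
  have "abelianization [b] c = (\<Sum>a\<in>A. k a * abelianization (\<sigma> [a]) c)" for c
  proof (cases "c \<in> B")
    case True
    then obtain i where i: "i < N" "bs ! i = c" using bs len by (metis in_set_conv_nth)
    have "(\<Sum>a\<in>A. k a * abelianization (\<sigma> [a]) c)
        = (\<Sum>l<N. k (as ! l) * abelianization (\<sigma> [as ! l]) c)"
      using sum.reindex_bij_betw[OF bij, of "\<lambda>a. k a * abelianization (\<sigma> [a]) c"] by simp
    also have "\<dots> = (\<Sum>l<N. det M * (M $$ (i, l) * K $$ (l, j)))"
    proof (intro sum.cong refl)
      fix l assume "l \<in> {..<N}"
      then have l: "l < N" by simp
      then have "M $$ (i, l) = abelianization (\<sigma> [as ! l]) c"
        using i by (simp add: M_def incidence_mat_def len abelianization_def N_def)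
      then show "k (as ! l) * abelianization (\<sigma> [as ! l]) c = det M * (M $$ (i, l) * K $$ (l, j))"
        by (simp add: k[OF l] ac_simps)
    qed
    also have "\<dots> = det M * (M * K) $$ (i, j)"
      using i(1) j(1) M K
      by (simp add: sum_distrib_left scalar_prod_def atLeast0LessThan)
    also have "\<dots> = det M * det M * (if i = j then 1 else 0)"
      unfolding MK using i(1) j(1) by simp
    also have "\<dots> = (if i = j then 1 else 0)"
      using det by (auto simp: M_def)
    also have "\<dots> = abelianization [b] c"
      using i j bs(1) len by (auto simp: abelianization_def nth_eq_iff_index_eq)
    finally show ?thesis by simp
  next
    case False
    have "abelianization (\<sigma> [a]) c = 0" if "a \<in> A" for a
      using abelianization_in_int_vectors[OF substitutionD(1)[OF sub, of "[a]"]] that False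
      by (auto simp: int_vectors_def)
    then show ?thesis using False b by (auto simp: abelianization_def)
  qed
  then show ?thesis by blast
qed

text \<open>Applying the linear action of \<open>\<rho>\<close> to the expression of a basis vector in terms of the columns
  of \<open>\<sigma>\<close> expresses the columns of \<open>\<rho>\<close> by those of \<open>\<rho> \<circ> \<sigma>\<close>.\<close>

lemma unimodular_descent:
  assumes \<sigma>: "substitution A B \<sigma>" "unimodular_subst A B \<sigma>"
    and \<rho>: "substitution B C \<rho>" and fin: "finite B"
    and span: "\<And>a. a \<in> A \<Longrightarrow> abelianization (\<rho> (\<sigma> [a])) \<in> int_fun.span S"
    and b: "b \<in> B"
  shows "abelianization (\<rho> [b]) \<in> int_fun.span S"
proof -
  obtain k where k: "\<And>c. abelianization [b] c = (\<Sum>a\<in>A. k a * abelianization (\<sigma> [a]) c)"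
    using unimodular_columns[OF \<sigma> b] by blast
  have "abelianization (\<rho> [b]) = (\<Sum>a\<in>A. (\<lambda>x. k a * abelianization (\<rho> (\<sigma> [a])) x))"
  proof
    fix x
    have "abelianization (\<rho> [b]) x
        = (\<Sum>c\<in>B. (\<Sum>a\<in>A. k a * abelianization (\<sigma> [a]) c) * abelianization (\<rho> [c]) x)"
      using abelianization_substitution[OF \<rho> fin, of "[b]" x] b by (simp add: k)
    also have "\<dots> = (\<Sum>a\<in>A. k a * (\<Sum>c\<in>B. abelianization (\<sigma> [a]) c * abelianization (\<rho> [c]) x))"
      unfolding sum_distrib_right sum_distrib_left by (subst sum.swap) (simp add: ac_simps)
    also have "\<dots> = (\<Sum>a\<in>A. k a * abelianization (\<rho> (\<sigma> [a])) x)"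
    proof (intro sum.cong refl arg_cong2[where f = "(*)"])
      fix a assume "a \<in> A"
      then have "\<sigma> [a] \<in> lists B" by (intro substitutionD(1)[OF \<sigma>(1)]) auto
      then show "(\<Sum>c\<in>B. abelianization (\<sigma> [a]) c * abelianization (\<rho> [c]) x)
          = abelianization (\<rho> (\<sigma> [a])) x"
        by (rule abelianization_substitution[OF \<rho> fin, symmetric])
    qed
    finally show "abelianization (\<rho> [b]) x
        = (\<Sum>a\<in>A. (\<lambda>x. k a * abelianization (\<rho> (\<sigma> [a])) x)) x"
      by (simp add: sum_fun_apply)
  qed
  also have "\<dots> \<in> int_fun.span S"
    by (intro int_fun.span_sum int_fun.span_scale span)
  finally show ?thesis .
qed

section \<open>Bi-infinite words from extendable languages\<close>

lemma factor_nth: "t < l \<Longrightarrow> factor x i l ! t = x (i + int t)"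
  by (simp add: factor_def)

lemma length_factor: "length (factor x i l) = l"
  by (simp add: factor_def)

lemma sublist_drop_take: "sublist (take l (drop i w)) w"
  by (metis sublist_order.order_trans sublist_drop sublist_take)

lemma sublist_closed_language:
  assumes "w \<in> language Y" "sublist v w"
  shows "v \<in> language Y"
proof -
  obtain x i l where x: "x \<in> Y" "w = factor x i l" using assms(1) unfolding language_def by blast
  obtain p s where w: "w = p @ v @ s" using assms(2) unfolding sublist_def by blast
  have "v = factor x (i + int (length p)) (length v)"
  proof (rule nth_equalityI)
    fix t assume t: "t < length v"
    have "l = length w" by (simp add: x(2) length_factor)
    then have "l = length p + length v + length s" by (simp add: w)
    then have "w ! (length p + t) = x (i + int (length p + t))"
      unfolding x(2) using t by (intro factor_nth) simp
    then show "v ! t = factor x (i + int (length p)) (length v) ! t"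
      using t by (simp add: w nth_append factor_nth add.assoc)
  qed (simp add: length_factor)
  then show ?thesis using x(1) unfolding language_def by blast
qed

text \<open>Extending \<open>w\<close> by one letter on both sides again and again gives nested words whose union,
  centred at \<open>w\<close>, is a bi-infinite word. Each of its factors lies in one of the nested words, hence
  in \<open>L\<close>.\<close>

lemma extendable_language_point:
  assumes w: "w \<in> L"
    and sub: "\<And>v v'. v' \<in> L \<Longrightarrow> sublist v v' \<Longrightarrow> v \<in> L"
    and ext: "\<And>v. v \<in> L \<Longrightarrow> \<exists>a b. a # v @ [b] \<in> L"
  shows "\<exists>x :: int \<Rightarrow> 'a. (\<forall>i l. factor x i l \<in> L) \<and> factor x 0 (length w) = w"
proof -
  obtain f g where fg: "\<And>v. v \<in> L \<Longrightarrow> f v # v @ [g v] \<in> L" using ext by metis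
  define W where "W k = ((\<lambda>v. f v # v @ [g v]) ^^ k) w" for k
  have W0: "W 0 = w" and WS: "W (Suc k) = f (W k) # W k @ [g (W k)]" for k
    by (simp_all add: W_def)
  have WL: "W k \<in> L" for k by (induction k) (simp_all add: W0 WS w fg)
  have len: "length (W k) = length w + 2 * k" for k by (induction k) (simp_all add: W0 WS)
  have shift: "W (k + d) ! (j + d) = W k ! j" if "j < length (W k)" for k d j
  proof (induction d)
    case (Suc d)
    have "j + d < length (W (k + d))" using that by (simp add: len)
    then show ?case using Suc by (simp add: WS nth_append)
  qed simp
  \<comment> \<open>Position \<open>i\<close> of the point is position \<open>i + k\<close> of the \<open>k\<close>-th extension, for every \<open>k > \<bar>i\<bar>\<close>.\<close>
  define x where "x i = W (nat \<bar>i\<bar> + 1) ! nat (i + \<bar>i\<bar> + 1)" for i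
  have x: "W K ! nat (i + int K) = x i" if K: "nat \<bar>i\<bar> + 1 \<le> K" for i K
  proof -
    define d where "d = K - (nat \<bar>i\<bar> + 1)"
    have Kd: "K = nat \<bar>i\<bar> + 1 + d" using K by (simp add: d_def)
    have eq: "nat (i + int K) = nat (i + \<bar>i\<bar> + 1) + d" unfolding Kd by simp
    have "nat (i + \<bar>i\<bar> + 1) < length (W (nat \<bar>i\<bar> + 1))"
      unfolding len by (cases "0 \<le> i") auto
    from shift[OF this, of d] show ?thesis unfolding x_def eq by (simp only: Kd[symmetric])
  qed
  have "factor x i l \<in> L" for i l
  proof -
    define K where "K = nat \<bar>i\<bar> + l + 1"
    define s where "s = nat (i + int K)"
    have sl: "s + l \<le> length (W K)" 
      unfolding s_def K_def len by (cases "0 \<le> i") auto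
    have "factor x i l = take l (drop s (W K))"
    proof (rule nth_equalityI)
      fix t assume "t < length (factor x i l)"
      then have t: "t < l" by (simp add: length_factor)
      have "nat \<bar>i + int t\<bar> + 1 \<le> K"
        using t unfolding K_def by (cases "0 \<le> i"; cases "0 \<le> i + int t") auto
      from x[OF this] have "x (i + int t) = W K ! nat (i + int t + int K)" by simp
      also have "nat (i + int t + int K) = s + t"
        unfolding s_def K_def by (cases "0 \<le> i") auto
      finally have "x (i + int t) = W K ! (s + t)" .
      then show "factor x i l ! t = take l (drop s (W K)) ! t"
        using t sl by (simp add: factor_nth)
    qed (use sl in \<open>simp add: length_factor\<close>)
    then show ?thesis using sub[OF WL[of K] sublist_drop_take] by simp
  qed
  moreover have "factor x 0 (length w) = w"
  proof (rule nth_equalityI)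
    fix t assume "t < length (factor x 0 (length w))"
    then have t: "t < length w" by (simp add: length_factor)
    have "nat (int t + \<bar>int t\<bar> + 1) = t + (t + 1)" "nat \<bar>int t\<bar> + 1 = t + 1" by auto
    then have "x (int t) = W (t + 1) ! (t + (t + 1))"
      unfolding x_def by (simp only:)
    also have "\<dots> = w ! t" using shift[of t 0 "t + 1"] t by (simp only: W0 add_0)
    finally show "factor x 0 (length w) ! t = w ! t" using t by (simp add: factor_nth)
  qed (simp add: length_factor)
  ultimately show ?thesis by blast
qed

section \<open>Return words\<close>

text \<open>Cutting \<open>w @ u\<close> at an inner occurrence of \<open>u\<close> gives two shorter words of the same kind, and
  words without inner occurrences are return words.\<close>

lemma abelianization_in_return_span:
  assumes "w @ u \<in> language Y" "prefix u (w @ u)" "w \<in> lists A"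
  shows "abelianization w \<in> int_fun.span (abelianization ` return_words A Y u)"
  using assms
proof (induction "length w" arbitrary: w rule: less_induct)
  case less
  let ?O = "occurrences u (w @ u)"
  obtain z where z: "w @ u = u @ z" using less.prems(2) unfolding prefix_def by blast
  have "take (length u) (w @ u) = u" unfolding z by simp
  then have in0: "0 \<in> ?O" unfolding occurrences_def by simp
  have inw: "length w \<in> ?O" by (simp add: occurrences_def)
  have le: "i \<le> length w" if "i \<in> ?O" for i using that by (simp add: occurrences_def)
  consider "w = []" | i where "i \<in> ?O" "0 < i" "i < length w" | "w \<noteq> []" "?O = {0, length w}"
  proof -
    have "?O = {0, length w}" if "\<And>i. i \<in> ?O \<Longrightarrow> 0 < i \<Longrightarrow> \<not> i < length w"
    proof
      show "?O \<subseteq> {0, length w}"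
      proof
        fix i assume i: "i \<in> ?O"
        with that[OF i] le[OF i] show "i \<in> {0, length w}" by auto
      qed
      show "{0, length w} \<subseteq> ?O" using in0 inw by blast
    qed
    then show thesis using that by blast
  qed
  then show ?case
  proof cases
    case 1
    then show ?thesis by (simp add: abelianization_Nil int_fun.span_zero)
  next
    case 2
    define w1 where "w1 = take i w"
    define w2 where "w2 = drop i w"
    have w: "w = w1 @ w2" by (simp add: w1_def w2_def)
    have l1: "length w1 = i" using 2 by (simp add: w1_def)
    have "take (length u) (w2 @ u) = u"
      using 2 by (simp add: occurrences_def w2_def)
    then have p2: "prefix u (w2 @ u)" using take_is_prefix[of "length u" "w2 @ u"] by simp
    then obtain r where r: "w2 @ u = u @ r" unfolding prefix_def by blast
    have wu: "w @ u = (w1 @ u) @ r" using w r by simp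
    have "prefix u (w1 @ u)"
      using less.prems(2) unfolding wu by (rule prefix_length_prefix) (auto simp: prefix_def)
    moreover have "w1 @ u \<in> language Y"
      by (rule sublist_closed_language[OF less.prems(1)]) (simp only: wu sublist_append_rightI)
    moreover have "w2 @ u \<in> language Y"
      by (rule sublist_closed_language[OF less.prems(1)]) (simp add: w sublist_append_leftI)
    moreover have "length w1 < length w" "length w2 < length w"
      using 2 by (simp_all add: w1_def w2_def)
    moreover have "w1 \<in> lists A" "w2 \<in> lists A" using less.prems(3) unfolding w by simp_all
    ultimately have "abelianization w1 \<in> int_fun.span (abelianization ` return_words A Y u)"
      "abelianization w2 \<in> int_fun.span (abelianization ` return_words A Y u)"
      using less.hyps p2 by blast+
    then show ?thesis unfolding w abelianization_append by (rule int_fun.span_add)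
  next
    case 3
    then have "w \<in> return_words A Y u"
      using less.prems by (simp add: return_words_def suffix_def)
    then show ?thesis by (intro int_fun.span_base) simp
  qed
qed

section \<open>The language of a primitive directive sequence\<close>

locale primitive_directive_sequence =
  fixes A :: "nat \<Rightarrow> 'a set" and \<tau> :: "nat \<Rightarrow> 'a list \<Rightarrow> 'a list"
  assumes directive: "directive_sequence A \<tau>" and primitive: "primitive_seq A \<tau>"
begin

definition generated :: "nat \<Rightarrow> 'a list set" where
  "generated n = {w. \<exists>m>n. \<exists>a\<in>A m. sublist w (subst_comp \<tau> n m [a])}"

lemma finite_alphabet: "finite (A n)"
  using directive by (simp add: directive_sequence_def alphabet_def)

lemma alphabet_nonempty: "A n \<noteq> {}"
proof -
  have "card (A n) \<ge> 2" using directive by (simp add: directive_sequence_def alphabet_def)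
  then show ?thesis by auto
qed

lemma substitution_step: "substitution (A (Suc n)) (A n) (\<tau> n)"
  using directive by (simp add: directive_sequence_def)

lemma subst_comp_refl: "subst_comp \<tau> n n = id"
  by (simp add: subst_comp_def)

lemma foldr_comp: "foldr (\<circ>) fs g = foldr (\<circ>) fs id \<circ> g"
  by (induction fs) (auto simp: fun_eq_iff)

lemma subst_comp_Suc: "n \<le> m \<Longrightarrow> subst_comp \<tau> n (Suc m) = subst_comp \<tau> n m \<circ> \<tau> m"
  using foldr_comp[of "map \<tau> [n..<m]" "\<tau> m"] by (simp add: subst_comp_def)

lemma subst_comp_trans:
  assumes "n \<le> m" "m \<le> k"
  shows "subst_comp \<tau> n k = subst_comp \<tau> n m \<circ> subst_comp \<tau> m k"
  using assms(2)
  by (induction k rule: dec_induct) (use assms(1) in \<open>auto simp: subst_comp_refl subst_comp_Suc\<close>)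

lemma substitution_subst_comp: "n \<le> m \<Longrightarrow> substitution (A m) (A n) (subst_comp \<tau> n m)"
proof (induction m rule: dec_induct)
  case base
  show ?case by (simp only: subst_comp_refl substitution_id)
next
  case (step m)
  then show ?case
    using substitution_comp[OF substitution_step step.IH] by (simp only: subst_comp_Suc)
qed

lemma subst_comp_letter:
  assumes "n \<le> m" "a \<in> A m"
  shows "subst_comp \<tau> n m [a] \<in> lists (A n)"
  using assms by (intro substitutionD(1)[OF substitution_subst_comp]) auto

lemma generated_lists: "generated n \<subseteq> lists (A n)"
proof
  fix w assume "w \<in> generated n"
  then obtain m a where "m > n" "a \<in> A m" "sublist w (subst_comp \<tau> n m [a])"
    unfolding generated_def by blast
  then have "set w \<subseteq> set (subst_comp \<tau> n m [a])" "set (subst_comp \<tau> n m [a]) \<subseteq> A n"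
    using subst_comp_letter[of n m a] by (auto dest: set_mono_sublist)
  then show "w \<in> lists (A n)" by auto
qed

lemma generated_sublist: "w \<in> generated n \<Longrightarrow> sublist v w \<Longrightarrow> v \<in> generated n"
  unfolding generated_def by (blast intro: sublist_order.order_trans)

lemma generated_subst_comp:
  assumes "n \<le> m" "w \<in> generated m"
  shows "subst_comp \<tau> n m w \<in> generated n"
proof -
  obtain k a where k: "k > m" "a \<in> A k" "sublist w (subst_comp \<tau> m k [a])"
    using assms(2) unfolding generated_def by blast
  have "sublist (subst_comp \<tau> n m w) (subst_comp \<tau> n m (subst_comp \<tau> m k [a]))"
    using k assms(1) subst_comp_letter[of m k a]
    by (intro substitution_sublist[OF substitution_subst_comp]) auto
  moreover have "subst_comp \<tau> n m (subst_comp \<tau> m k [a]) = subst_comp \<tau> n k [a]"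
    using subst_comp_trans[of n m k] k assms(1) by simp
  ultimately show ?thesis
    using k assms(1) unfolding generated_def by (auto intro!: exI[of _ k])
qed

lemma letter_generated: "a \<in> A n \<Longrightarrow> [a] \<in> generated n"
  using substitutionD(5)[OF substitution_subst_comp[of n "Suc n"], of a]
  unfolding generated_def by (auto simp: sublist_singleton_iff)

lemma generated_in_all_images:
  assumes "w \<in> generated n"
  shows "\<exists>m>n. \<forall>b\<in>A m. sublist w (subst_comp \<tau> n m [b])"
proof -
  obtain k a where k: "k > n" "a \<in> A k" "sublist w (subst_comp \<tau> n k [a])"
    using assms unfolding generated_def by blast
  obtain m where m: "m > k" "\<And>b. b \<in> A m \<Longrightarrow> a \<in> set (subst_comp \<tau> k m [b])"
    using primitive k(2) unfolding primitive_seq_def by metis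
  have "sublist w (subst_comp \<tau> n m [b])" if b: "b \<in> A m" for b
  proof -
    have "sublist (subst_comp \<tau> n k [a]) (subst_comp \<tau> n k (subst_comp \<tau> k m [b]))"
      using k m b subst_comp_letter[of k m b]
      by (intro substitution_sublist[OF substitution_subst_comp])
        (auto simp: sublist_singleton_iff)
    also have "subst_comp \<tau> n k (subst_comp \<tau> k m [b]) = subst_comp \<tau> n m [b]"
      using subst_comp_trans[of n k m] k m by simp
    finally show ?thesis using k(3) sublist_order.order_trans by blast
  qed
  then show ?thesis using k(1) m(1) by (meson less_trans)
qed

text \<open>Some image at level \<open>m\<close> contains all letters, and there are at least two of them.\<close>

lemma two_letter_generated: "\<exists>b c. [b, c] \<in> generated m"
proof -
  obtain k where k: "k > m" "\<forall>b\<in>A m. \<forall>a\<in>A k. b \<in> set (subst_comp \<tau> m k [a])"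
    using primitive unfolding primitive_seq_def by blast
  obtain a where a: "a \<in> A k" using alphabet_nonempty by blast
  define v where "v = subst_comp \<tau> m k [a]"
  have "2 \<le> card (A m)" using directive by (simp add: directive_sequence_def alphabet_def)
  also have "\<dots> \<le> card (set v)" using k a by (intro card_mono) (auto simp: v_def)
  also have "\<dots> \<le> length v" by (rule card_length)
  finally obtain b c r where v: "v = b # c # r"
    by (cases v; cases "tl v") auto
  have "v \<in> generated m" using k(1) a unfolding generated_def v_def by blast
  moreover have "sublist [b, c] v" unfolding v sublist_def by (metis append_Cons append_Nil)
  ultimately show ?thesis using generated_sublist by blast
qed

text \<open>A word that occurs in every image occurs twice, without overlap, in the image of a two-letter
  word, so it is followed (first copy) and preceded (second copy) by a letter.\<close>

lemma generated_extend_one_side: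
  assumes "w \<in> generated n"
  shows "\<exists>y. w @ [y] \<in> generated n" and "\<exists>x. x # w \<in> generated n"
proof -
  obtain m where m: "m > n" "\<And>b. b \<in> A m \<Longrightarrow> sublist w (subst_comp \<tau> n m [b])"
    using generated_in_all_images[OF assms] by blast
  obtain b c where bc: "[b, c] \<in> generated m" using two_letter_generated by blast
  then have bcA: "b \<in> A m" "c \<in> A m" using generated_lists[of m] by auto
  note sub = substitution_subst_comp[OF less_imp_le[OF m(1)]]
  have eq: "subst_comp \<tau> n m [b, c] = subst_comp \<tau> n m [b] @ subst_comp \<tau> n m [c]"
    using substitutionD(3)[OF sub, of "[b]" "[c]"] bcA by auto
  have gen: "subst_comp \<tau> n m [b] @ subst_comp \<tau> n m [c] \<in> generated n"
    using generated_subst_comp[OF less_imp_le[OF m(1)] bc] by (simp add: eq)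
  have ne: "subst_comp \<tau> n m [b] \<noteq> []" "subst_comp \<tau> n m [c] \<noteq> []"
    using substitutionD(4)[OF sub] bcA by auto
  obtain p q where b: "subst_comp \<tau> n m [b] = p @ w @ q"
    using m(2)[OF bcA(1)] unfolding sublist_def by blast
  obtain p' q' where c: "subst_comp \<tau> n m [c] = p' @ w @ q'"
    using m(2)[OF bcA(2)] unfolding sublist_def by blast
  obtain y z where y: "q @ subst_comp \<tau> n m [c] = y # z"
    using ne(2) by (cases "q @ subst_comp \<tau> n m [c]") auto
  have "subst_comp \<tau> n m [b] @ subst_comp \<tau> n m [c] = p @ (w @ [y]) @ z"
    using y by (simp add: b)
  then have "sublist (w @ [y]) (subst_comp \<tau> n m [b] @ subst_comp \<tau> n m [c])"
    unfolding sublist_def by blast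
  then show "\<exists>y. w @ [y] \<in> generated n" using gen generated_sublist by blast
  obtain x z' where x: "subst_comp \<tau> n m [b] @ p' = z' @ [x]"
    using ne(1) by (cases "subst_comp \<tau> n m [b] @ p'" rule: rev_cases) auto
  have "subst_comp \<tau> n m [b] @ subst_comp \<tau> n m [c] = (subst_comp \<tau> n m [b] @ p') @ w @ q'"
    by (simp add: c)
  also have "\<dots> = z' @ (x # w) @ q'" unfolding x by simp
  finally have "sublist (x # w) (subst_comp \<tau> n m [b] @ subst_comp \<tau> n m [c])"
    unfolding sublist_def by blast
  then show "\<exists>x. x # w \<in> generated n" using gen generated_sublist by blast
qed

text \<open>This makes the bi-infinite points disappear from the rest of the argument: membership in the
  language can be checked, and produced, on images of letters.\<close>

lemma language_level_subshift: "language (level_subshift A \<tau> n) = generated n"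
proof
  show "language (level_subshift A \<tau> n) \<subseteq> generated n"
    unfolding language_def level_subshift_def generated_def by blast
  show "generated n \<subseteq> language (level_subshift A \<tau> n)"
  proof
    fix w assume w: "w \<in> generated n"
    have "\<exists>a b. a # v @ [b] \<in> generated n" if "v \<in> generated n" for v
      using generated_extend_one_side that by metis
    then obtain x where x: "\<And>i l. factor x i l \<in> generated n" "factor x 0 (length w) = w"
      using extendable_language_point[OF w] generated_sublist by metis
    have "x i \<in> A n" for i
      using x(1)[of i 1] generated_lists[of n] by (auto simp: factor_def)
    then have "x \<in> level_subshift A \<tau> n"
      using x(1) unfolding level_subshift_def generated_def by blast
    then show "w \<in> language (level_subshift A \<tau> n)"
      using x(2)[symmetric] unfolding language_def by blast
  qed
qed

section \<open>Images of letters and return words\<close>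

text \<open>Properness gives the images of all letters a common prefix \<open>p @ u\<close>. The image of a two-letter
  word \<open>[a, c]\<close> then contains a block from one occurrence of \<open>u\<close> to another that is a cyclic rotation
  of the image of \<open>a\<close>, and abelianization does not see the rotation.\<close>

lemma generator_image_in_span:
  assumes proper: "proper_seq A \<tau>" and u: "u \<in> generated n"
  shows "\<exists>m\<ge>n. \<forall>a\<in>A m. abelianization (subst_comp \<tau> n m [a])
    \<in> int_fun.span (abelianization ` return_words (A n) (level_subshift A \<tau> n) u)"
proof -
  obtain m where m: "m > n" "\<And>b. b \<in> A m \<Longrightarrow> sublist u (subst_comp \<tau> n m [b])"
    using generated_in_all_images[OF u] by blast
  obtain b where b: "b \<in> A m" "\<And>a. a \<in> A (Suc m) \<Longrightarrow> prefix [b] (\<tau> m [a])"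
    using proper unfolding proper_seq_def proper_subst_def by blast
  obtain p s where ps: "subst_comp \<tau> n m [b] = p @ u @ s"
    using m(2)[OF b(1)] unfolding sublist_def by blast
  note sub = substitution_subst_comp[OF less_imp_le[OF m(1)]]
  have "n \<le> Suc m" using m(1) by simp
  note sub' = substitution_subst_comp[OF this]
  have pu: "\<exists>r. subst_comp \<tau> n (Suc m) [a] = p @ u @ r" if a: "a \<in> A (Suc m)" for a
  proof -
    obtain t where t: "\<tau> m [a] = [b] @ t" using b(2)[OF a] unfolding prefix_def by blast
    have "\<tau> m [a] \<in> lists (A m)" using a by (intro substitutionD(1)[OF substitution_step]) auto
    then have "subst_comp \<tau> n m (\<tau> m [a]) = subst_comp \<tau> n m [b] @ subst_comp \<tau> n m t"
      unfolding t by (intro substitutionD(3)[OF sub]) auto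
    then show ?thesis using m(1) by (simp add: subst_comp_Suc ps)
  qed
  have "abelianization (subst_comp \<tau> n (Suc m) [a])
    \<in> int_fun.span (abelianization ` return_words (A n) (level_subshift A \<tau> n) u)"
    if a: "a \<in> A (Suc m)" for a
  proof -
    obtain c where c: "[a] @ [c] \<in> generated (Suc m)"
      using generated_extend_one_side(1)[OF letter_generated[OF a]] by blast
    then have cA: "c \<in> A (Suc m)" using generated_lists[of "Suc m"] by auto
    obtain r where r: "subst_comp \<tau> n (Suc m) [a] = p @ u @ r" using pu[OF a] by blast
    obtain r' where r': "subst_comp \<tau> n (Suc m) [c] = p @ u @ r'" using pu[OF cA] by blast
    have "subst_comp \<tau> n (Suc m) ([a] @ [c]) = (p @ u @ r) @ p @ u @ r'"
      using substitutionD(3)[OF sub', of "[a]" "[c]"] a cA r r' by auto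
    then have gen: "(p @ u @ r) @ p @ u @ r' \<in> generated n"
      using generated_subst_comp[OF _ c, of n] m(1) by simp
    have "sublist ((u @ r @ p) @ u) ((p @ u @ r) @ p @ u @ r')"
      unfolding sublist_def by (rule exI[of _ p], rule exI[of _ r']) simp
    then have urp: "(u @ r @ p) @ u \<in> generated n" using gen generated_sublist by blast
    then have "u @ r @ p \<in> lists (A n)" using generated_lists[of n] by auto
    with urp have "abelianization (u @ r @ p)
        \<in> int_fun.span (abelianization ` return_words (A n) (level_subshift A \<tau> n) u)"
      by (intro abelianization_in_return_span) (auto simp: language_level_subshift)
    moreover have "abelianization (u @ r @ p) = abelianization (subst_comp \<tau> n (Suc m) [a])"
      by (simp add: r abelianization_append ac_simps)
    ultimately show ?thesis by simp
  qed
  then show ?thesis using m(1) by (intro exI[of _ "Suc m"]) auto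
qed

text \<open>The composed substitution is removed one unimodular factor at a time, from the innermost factor
  outwards, until the images of letters are the letters themselves.\<close>

lemma letters_in_span:
  assumes uni: "unimodular_seq A \<tau>" and "n \<le> m"
    and "\<And>a. a \<in> A m \<Longrightarrow> abelianization (subst_comp \<tau> n m [a]) \<in> int_fun.span S"
    and "a \<in> A n"
  shows "abelianization [a] \<in> int_fun.span S"
  using assms(2-)
proof (induction m arbitrary: a rule: dec_induct)
  case base
  then show ?case by (simp add: subst_comp_refl)
next
  case (step m)
  have "abelianization (subst_comp \<tau> n m [b]) \<in> int_fun.span S" if b: "b \<in> A m" for b
  proof (rule unimodular_descent[OF substitution_step _ substitution_subst_comp finite_alphabet _ b])
    show "unimodular_subst (A (Suc m)) (A m) (\<tau> m)" using uni by (simp add: unimodular_seq_def)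
    show "n \<le> m" by (rule step.hyps)
    show "abelianization (subst_comp \<tau> n m (\<tau> m [a])) \<in> int_fun.span S" if "a \<in> A (Suc m)" for a
      using step.prems(1)[OF that] step.hyps by (simp add: subst_comp_Suc)
  qed
  then show ?case using step.IH step.prems(2) by blast
qed

lemma return_words_generate:
  assumes "proper_seq A \<tau>" "unimodular_seq A \<tau>" and u: "u \<in> language (level_subshift A \<tau> n)"
  shows "int_combinations (abelianization ` return_words (A n) (level_subshift A \<tau> n) u)
    = int_vectors (A n)"
proof -
  let ?S = "abelianization ` return_words (A n) (level_subshift A \<tau> n) u"
  obtain m where "m \<ge> n" "\<And>a. a \<in> A m \<Longrightarrow> abelianization (subst_comp \<tau> n m [a]) \<in> int_fun.span ?S"
    using generator_image_in_span[OF assms(1)] u unfolding language_level_subshift by metis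
  then have "abelianization [a] \<in> int_fun.span ?S" if "a \<in> A n" for a
    using letters_in_span[OF assms(2)] that by blast
  then have "int_vectors (A n) \<subseteq> int_fun.span ?S"
    by (intro int_vectors_subset_span finite_alphabet)
  moreover have "int_fun.span ?S \<subseteq> int_vectors (A n)"
    by (rule span_subset_int_vectors) (auto simp: return_words_def)
  ultimately show ?thesis unfolding int_combinations_eq_span by blast
qed

end

section \<open>Letter-coboundaries\<close>

text \<open>A letter-coboundary is a linear functional of the abelianization that vanishes on return words,
  hence on their span, which contains the basis vectors.\<close>

lemma letter_coboundary_trivial:
  assumes c: "letter_coboundary A Y c" and fin: "finite A" and a: "a \<in> A"
    and span: "int_combinations (abelianization ` return_words A Y [a]) = int_vectors A"
    and b: "b \<in> A"
  shows "c [b] = 0"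
proof -
  have nil: "c [] = 0" and add: "\<And>v w. v \<in> lists A \<Longrightarrow> w \<in> lists A \<Longrightarrow> c (v @ w) = c v + c w"
    and ret: "\<And>w. w \<in> return_words A Y [a] \<Longrightarrow> c w = 0"
    using c a unfolding letter_coboundary_def by auto
  define \<phi> :: "('a \<Rightarrow> int) \<Rightarrow> real" where "\<phi> v = (\<Sum>x\<in>A. of_int (v x) * c [x])" for v
  have \<phi>: "\<phi> (abelianization w) = c w" if "w \<in> lists A" for w
    using that
  proof (induction w)
    case Nil
    then show ?case by (simp add: \<phi>_def abelianization_def nil)
  next
    case (Cons x w)
    have "\<phi> (abelianization (x # w)) =
        (\<Sum>y\<in>A. (if y = x then c [y] else 0) + of_int (abelianization w y) * c [y])"
      unfolding \<phi>_def by (intro sum.cong) (auto simp: abelianization_def algebra_simps)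
    also have "\<dots> = c [x] + c w"
      using Cons fin by (simp add: sum.distrib \<phi>_def)
    also have "\<dots> = c (x # w)" using add[of "[x]" w] Cons by simp
    finally show ?case .
  qed
  have "int_fun.subspace {v. \<phi> v = 0}"
  proof (rule int_fun.subspaceI)
    fix k v assume "v \<in> {v. \<phi> v = 0}"
    moreover have "\<phi> (\<lambda>a. k * v a) = of_int k * \<phi> v"
      by (simp add: \<phi>_def sum_distrib_left mult.assoc)
    ultimately show "(\<lambda>a. k * v a) \<in> {v. \<phi> v = 0}" by simp
  qed (simp_all add: \<phi>_def distrib_right sum.distrib)
  moreover have "w \<in> lists A" if "w \<in> return_words A Y [a]" for w
    using that unfolding return_words_def by blast
  then have "abelianization ` return_words A Y [a] \<subseteq> {v. \<phi> v = 0}"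
    using ret \<phi> by (auto simp del: lists_eq_set)
  ultimately have "int_vectors A \<subseteq> {v. \<phi> v = 0}"
    unfolding span[symmetric] int_combinations_eq_span by (intro int_fun.span_minimal)
  moreover have "abelianization [b] \<in> int_vectors A"
    using b by (intro abelianization_in_int_vectors) auto
  ultimately show ?thesis using \<phi>[of "[b]"] b by auto
qed

theorem theorem6p17:
  fixes A :: "nat \<Rightarrow> 'a set"
    and \<tau> :: "nat \<Rightarrow> 'a list \<Rightarrow> 'a list"
    and X :: "(int \<Rightarrow> 'a) set"
  assumes "directive_sequence A \<tau>"
    and "proper_seq A \<tau>"
    and "unimodular_seq A \<tau>"
    and "primitive_seq A \<tau>"
    and "subshift (A 0) X"
    and "generates A \<tau> X"
  shows "(\<forall>n. \<forall>u \<in> language (level_subshift A \<tau> n). u \<noteq> [] \<longrightarrow>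
            int_combinations (abelianization ` return_words (A n) (level_subshift A \<tau> n) u)
              = int_vectors (A n)) \<and>
         (\<forall>n c. letter_coboundary (A n) (level_subshift A \<tau> n) c \<longrightarrow>
            trivial_coboundary (A n) c)"
proof -
  interpret primitive_directive_sequence A \<tau>
    using assms(1,4) by unfold_locales
  note generate = return_words_generate[OF assms(2,3)]
  have "c [a] = 0" if "letter_coboundary (A n) (level_subshift A \<tau> n) c" "a \<in> A n" for n c a
  proof (rule letter_coboundary_trivial[OF that(1) finite_alphabet that(2) _ that(2)])
    have "[a] \<in> language (level_subshift A \<tau> n)"
      using letter_generated[OF that(2)] by (simp add: language_level_subshift)
    then show "int_combinations (abelianization ` return_words (A n) (level_subshift A \<tau> n) [a])
        = int_vectors (A n)"
      by (rule generate)
  qed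
  then show ?thesis using generate by (auto simp: trivial_coboundary_def)
qed

end
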